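(* Let $s=s(n)$ be a positive integer valued function, and let $M_o(s,n)$ denote the minimum of $op(\mathcal A)$ among all odd-sized families $\mathcal A\subset 2^{[n]}$ with $|\mathcal A|=n+s$. If $s=cn+o(n)$ for some constant $c>0$, then $$M_o(s,n)=\left(\binom{\lfloor c\rfloor+1}{2}+(\lfloor c\rfloor+1)(c-\lfloor c\rfloor)\right)n+o(n).$$
   Context: $[n]=\{1,2,\ldots,n\}$ and $2^{[n]}$ is the collection of all subsets of $[n]$. A family $\mathcal A\subset 2^{[n]}$ is a set of (distinct) subsets of $[n]$; it is odd-sized if every member has odd cardinality. The odd pair number $op(\mathcal A)$ is the number of (unordered) pairs of distinct members $A,B\in\mathcal A$ such that $|A\cap B|$ is odd. The asymptotic notation $o(\cdot)$ is as $n\to\infty$. *)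

theory Defs
  imports Complex_Main "HOL-Library.Landau_Symbols"
begin

definition odd_sized :: "nat set set \<Rightarrow> bool" where
  "odd_sized \<A> \<longleftrightarrow> (\<forall>A\<in>\<A>. odd (card A))"

definition op_number :: "nat set set \<Rightarrow> nat" where
  "op_number \<A> = card {{A, B} | A B. A \<in> \<A> \<and> B \<in> \<A> \<and> A \<noteq> B \<and> odd (card (A \<inter> B))}"

definition odd_families :: "nat \<Rightarrow> nat \<Rightarrow> nat set set set" where
  "odd_families s n = {\<A>. \<A> \<subseteq> Pow {1..n} \<and> odd_sized \<A> \<and> card \<A> = n + s}"

(* If n + s > 2^(n-1), no such family exists and the value is unspecified. When s = s(n) grows
   linearly this affects only finitely many n, so it is irrelevant for asymptotics. *)
definition M_o :: "nat \<Rightarrow> nat \<Rightarrow> nat" where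
  "M_o s n = Min (op_number ` odd_families s n)"

end

theory Submission
  imports Defs
begin

text \<open>
  Regard a family \<open>\<A>\<close> as the vertex set of a graph in which two members are adjacent when their
  intersection is odd, so that \<open>op_number \<A>\<close> counts edges. An independent set of this graph is
  an odd-sized family with even pairwise intersections, and by the oddtown theorem
  (\<open>oddtown\<close>) it has at most \<open>n\<close> members. The problem is therefore of Turan type: among graphs on
  \<open>N = n + s\<close> vertices with independence number at most \<open>n\<close>, a disjoint union of \<open>n\<close> cliques of
  nearly equal sizes has the fewest edges. The number of edges of such a union is
  \<open>\<Sum>i\<ge>1. max 0 (N - i * n)\<close>, and it is convenient to keep it in this form throughout.

  The lower bound (\<open>edges_ge_of_independence_bound\<close>) peels off largest independent sets: each has at
  most \<open>n\<close> vertices, and each remaining vertex sends an edge into it. For the upper bound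
  (\<open>exists_family_few_odd_pairs\<close>), the \<open>i\<close>-th clique consists of sets that share the point
  \<open>i\<close> and are told apart by disjoint two-element sets, which contribute an even amount to every
  intersection. A bounded number \<open>L\<close> of two-element sets suffices; they use up \<open>2 * L\<close> of
  the \<open>n\<close> points, so there are \<open>n - 2 * L\<close> cliques instead of \<open>n\<close>. After division by \<open>n\<close> both bounds
  tend to \<open>\<Sum>i\<ge>1. max 0 (1 + c - i)\<close>, which is the claimed constant.
\<close>

section \<open>Graphs with small independence number\<close>

definition edges :: "('a \<Rightarrow> 'a \<Rightarrow> bool) \<Rightarrow> 'a set \<Rightarrow> 'a set set" where
  "edges R V = {{a, b} | a b. a \<in> V \<and> b \<in> V \<and> a \<noteq> b \<and> R a b}"

definition independent_set :: "('a \<Rightarrow> 'a \<Rightarrow> bool) \<Rightarrow> 'a set \<Rightarrow> bool" where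
  "independent_set R I \<longleftrightarrow> (\<forall>a\<in>I. \<forall>b\<in>I. a \<noteq> b \<longrightarrow> \<not> R a b)"

lemma finite_edges: "finite V \<Longrightarrow> finite (edges R V)"
  by (rule finite_subset[of _ "Pow V"]) (auto simp: edges_def)

lemma exists_largest_independent:
  assumes "finite V"
  obtains I where "I \<subseteq> V" "independent_set R I"
    "\<And>J. J \<subseteq> V \<Longrightarrow> independent_set R J \<Longrightarrow> card J \<le> card I"
proof -
  let ?S = "{I. I \<subseteq> V \<and> independent_set R I}"
  have fin: "finite ?S" using assms by simp
  have "{} \<in> ?S" by (simp add: independent_set_def)
  then have "Max (card ` ?S) \<in> card ` ?S" using fin by (intro Max_in) auto
  then obtain I where I: "Max (card ` ?S) = card I" "I \<in> ?S" by (rule imageE)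
  have "card J \<le> card I" if "J \<in> ?S" for J
    using that fin by (simp flip: I(1))
  with I show ?thesis using that by auto
qed

text \<open>
  By maximality every vertex \<open>v\<close> outside \<open>I\<close> has a neighbour \<open>f v\<close> in \<open>I\<close>. The edges \<open>{v, f v}\<close> are
  distinct for distinct \<open>v\<close>, and none of them lies inside \<open>V - I\<close>.
\<close>
lemma edges_ge_remove_largest_independent:
  assumes fin: "finite V" and sym: "\<And>a b. R a b \<Longrightarrow> R b a"
    and I: "I \<subseteq> V" "independent_set R I"
    and max: "\<And>J. J \<subseteq> V \<Longrightarrow> independent_set R J \<Longrightarrow> card J \<le> card I"
  shows "card (V - I) + card (edges R (V - I)) \<le> card (edges R V)"
proof -
  have "\<exists>u\<in>I. R v u" if v: "v \<in> V - I" for v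
  proof (rule ccontr)
    assume no: "\<not> (\<exists>u\<in>I. R v u)"
    then have "independent_set R (insert v I)"
      using I(2) sym by (auto simp: independent_set_def)
    moreover have "insert v I \<subseteq> V" using v I by auto
    ultimately have "card (insert v I) \<le> card I" by (rule max[rotated])
    moreover have "finite I" using I fin finite_subset by blast
    ultimately show False using v by simp
  qed
  then obtain f where f: "\<And>v. v \<in> V - I \<Longrightarrow> f v \<in> I \<and> R v (f v)" by metis
  let ?S = "(\<lambda>v. {v, f v}) ` (V - I)"
  have inj: "inj_on (\<lambda>v. {v, f v}) (V - I)"
  proof (rule inj_onI)
    fix v w assume "v \<in> V - I" "w \<in> V - I" "{v, f v} = {w, f w}"
    then show "v = w" using f[of v] f[of w] by (auto simp: doubleton_eq_iff)
  qed
  have disj: "?S \<inter> edges R (V - I) = {}"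
  proof -
    have "f v \<in> {v, f v} - (V - I)" if "v \<in> V - I" for v using f[OF that] by auto
    moreover have "e \<subseteq> V - I" if "e \<in> edges R (V - I)" for e
      using that by (auto simp: edges_def)
    ultimately show ?thesis by blast
  qed
  have "?S \<subseteq> edges R V"
  proof
    fix e assume "e \<in> ?S"
    then obtain v where v: "v \<in> V - I" "e = {v, f v}" by auto
    then have "v \<in> V" "f v \<in> V" "v \<noteq> f v" "R v (f v)" using f[of v] I by auto
    then show "e \<in> edges R V" using v by (auto simp: edges_def)
  qed
  moreover have "edges R (V - I) \<subseteq> edges R V" by (auto simp: edges_def)
  ultimately have "card (?S \<union> edges R (V - I)) \<le> card (edges R V)"
    by (intro card_mono finite_edges fin) auto
  moreover have "card (?S \<union> edges R (V - I)) = card (V - I) + card (edges R (V - I))"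
    using disj inj fin by (simp add: card_Un_disjoint finite_edges card_image)
  ultimately show ?thesis by simp
qed

text \<open>
  Turan's theorem for the complement graph, in an additive form. A largest independent set \<open>I\<close> has
  at most \<open>n\<close> vertices, so its removal leaves at least \<open>card V - n\<close> vertices and destroys at least
  that many edges; iterating \<open>j\<close> times gives the summands one by one. The natural-number subtraction is
  truncated on purpose: the summands with \<open>i * n \<ge> card V\<close> vanish, so the bound is optimal as soon
  as \<open>j\<close> is large.
\<close>
lemma edges_ge_of_independence_bound:
  assumes "finite V" and sym: "\<And>a b. R a b \<Longrightarrow> R b a"
    and "\<And>J. J \<subseteq> V \<Longrightarrow> independent_set R J \<Longrightarrow> card J \<le> n"
  shows "(\<Sum>i=1..j. card V - i * n) \<le> card (edges R V)"
  using assms(1,3)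
proof (induction j arbitrary: V)
  case 0
  then show ?case by simp
next
  case (Suc j)
  obtain I where I: "I \<subseteq> V" "independent_set R I"
    and max: "\<And>J. J \<subseteq> V \<Longrightarrow> independent_set R J \<Longrightarrow> card J \<le> card I"
    using exists_largest_independent[OF Suc.prems(1)] by blast
  let ?W = "V - I"
  have "card I \<le> n" using Suc.prems(2) I by blast
  moreover have "card ?W = card V - card I"
    using I Suc.prems(1) by (intro card_Diff_subset) (auto intro: finite_subset)
  ultimately have W: "card V - n \<le> card ?W" by simp
  have IH: "(\<Sum>i=1..j. card ?W - i * n) \<le> card (edges R ?W)"
    using Suc.prems by (intro Suc.IH) auto
  have "(\<Sum>i=1..Suc j. card V - i * n) = (card V - n) + (\<Sum>i=1..j. card V - Suc i * n)"
    by (subst sum.atLeast_Suc_atMost) (simp_all add: sum.shift_bounds_cl_Suc_ivl del: sum.cl_ivl_Suc)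
  also have "\<dots> \<le> card ?W + (\<Sum>i=1..j. card ?W - i * n)"
    using W by (intro add_mono sum_mono) auto
  also have "\<dots> \<le> card ?W + card (edges R ?W)" using IH by simp
  also have "\<dots> \<le> card (edges R V)"
    by (rule edges_ge_remove_largest_independent[OF Suc.prems(1) sym I max])
  finally show ?case .
qed

section \<open>The lower bound\<close>

text \<open>
  The members of \<open>F\<close>, read as vectors over the field with two elements, are orthonormal and hence
  linearly independent. In counting form: the map that sends a subfamily \<open>S\<close> to its symmetric
  difference is injective, because \<open>S\<close> consists of exactly those \<open>A \<in> F\<close> that meet the
  symmetric difference in an odd number of points. Thus \<open>2 ^ card F \<le> 2 ^ card X\<close>.
\<close>
lemma oddtown:
  assumes X: "finite X" and F: "F \<subseteq> Pow X"
    and odd: "\<And>A. A \<in> F \<Longrightarrow> odd (card A)"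
    and even: "\<And>A B. A \<in> F \<Longrightarrow> B \<in> F \<Longrightarrow> A \<noteq> B \<Longrightarrow> even (card (A \<inter> B))"
  shows "card F \<le> card X"
proof -
  have finF: "finite F" using finite_subset[OF F] X by simp
  define D where "D S = {x \<in> X. odd (card {B \<in> S. x \<in> B})}" for S
  have key: "odd (card (A \<inter> D S)) \<longleftrightarrow> A \<in> S" if A: "A \<in> F" and S: "S \<subseteq> F" for A S
  proof -
    have finA: "finite A" using A F X by (auto intro: finite_subset)
    have finS: "finite S" using S finF finite_subset by blast
    have "A \<inter> D S = {x \<in> A. odd (card {B \<in> S. x \<in> B})}"
      using A F by (auto simp: D_def)
    then have "odd (card (A \<inter> D S)) \<longleftrightarrow> odd (\<Sum>x\<in>A. card {B \<in> S. x \<in> B})"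
      using finA by (simp add: even_sum_iff)
    also have "(\<Sum>x\<in>A. card {B \<in> S. x \<in> B}) = (\<Sum>B\<in>S. card (A \<inter> B))"
      using sum.swap_restrict[OF finA finS, of "\<lambda>_ _. 1::nat" "\<lambda>x B. x \<in> B"]
      by (simp add: Int_def)
    also have "odd (\<Sum>B\<in>S. card (A \<inter> B)) \<longleftrightarrow> odd (card {B \<in> S. odd (card (A \<inter> B))})"
      using finS by (simp add: even_sum_iff)
    also have "{B \<in> S. odd (card (A \<inter> B))} = {A} \<inter> S"
      using A S odd even by fastforce
    finally show ?thesis by (cases "A \<in> S") auto
  qed
  have "inj_on D (Pow F)"
  proof (rule inj_onI)
    fix S T assume "S \<in> Pow F" "T \<in> Pow F" "D S = D T"
    then show "S = T" using key[of _ S] key[of _ T] by auto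
  qed
  moreover have "D ` Pow F \<subseteq> Pow X" by (auto simp: D_def)
  ultimately have "card (Pow F) \<le> card (Pow X)"
    using X by (intro card_inj_on_le) auto
  then show ?thesis using finF X by (simp add: card_Pow)
qed

lemma op_number_ge:
  assumes "\<A> \<in> odd_families s n"
  shows "(\<Sum>i=1..j. (n + s) - i * n) \<le> op_number \<A>"
proof -
  let ?R = "\<lambda>A B::nat set. odd (card (A \<inter> B))"
  have A: "\<A> \<subseteq> Pow {1..n}" "\<And>A. A \<in> \<A> \<Longrightarrow> odd (card A)" "card \<A> = n + s"
    using assms by (auto simp: odd_families_def odd_sized_def)
  have "card J \<le> n" if "J \<subseteq> \<A>" "independent_set ?R J" for J
  proof -
    have "card J \<le> card {1..n}"
      using that A by (intro oddtown) (auto simp: independent_set_def)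
    then show ?thesis by simp
  qed
  moreover have "finite \<A>" using A(1) finite_subset by blast
  ultimately have "(\<Sum>i=1..j. card \<A> - i * n) \<le> card (edges ?R \<A>)"
    by (intro edges_ge_of_independence_bound) (auto simp: Int_commute)
  then show ?thesis using A(3) by (simp add: op_number_def edges_def)
qed

section \<open>The construction\<close>

text \<open>
  The residue \<open>t mod m\<close> is the index of the clique. The last two points form the two-element set
  with index \<open>t div m\<close>; they keep the triples of one clique distinct without affecting parities.
\<close>
definition triple :: "nat \<Rightarrow> nat \<Rightarrow> nat set" where
  "triple m t = {1 + t mod m, m + 2 * (t div m) + 1, m + 2 * (t div m) + 2}"

lemma triple_Int:
  assumes "m > 0"
  shows "triple m t \<inter> triple m u =
    (if t mod m = u mod m then {1 + t mod m} else {}) \<union>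
    (if t div m = u div m then {m + 2 * (t div m) + 1, m + 2 * (t div m) + 2} else {})"
proof -
  have "{1 + a, m + 2 * p + 1, m + 2 * p + 2} \<inter> {1 + b, m + 2 * q + 1, m + 2 * q + 2} =
      (if a = b then {1 + a} else {}) \<union> (if p = q then {m + 2 * p + 1, m + 2 * p + 2} else {})"
    if "a < m" "b < m" for a b p q
  proof -
    have "2 * p + 1 \<noteq> 2 * q + 2" "2 * q + 1 \<noteq> 2 * p + 2" by presburger+
    then show ?thesis using that by auto
  qed
  then show ?thesis unfolding triple_def using assms by simp
qed

lemma odd_card_triple_Int:
  assumes "m > 0"
  shows "odd (card (triple m t \<inter> triple m u)) \<longleftrightarrow> t mod m = u mod m"
proof -
  have "t mod m < m" using assms by auto
  then have "1 + t mod m \<notin> {m + 2 * (t div m) + 1, m + 2 * (t div m) + 2}" by auto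
  then show ?thesis unfolding triple_Int[OF assms] by auto
qed

lemma inj_triple:
  assumes "m > 0"
  shows "inj (triple m)"
proof (rule injI)
  fix t u assume eq: "triple m t = triple m u"
  have lt: "t mod m < m" "u mod m < m" using assms by auto
  then have "triple m t \<inter> {1..m} = {1 + t mod m}" "triple m u \<inter> {1..m} = {1 + u mod m}"
    by (auto simp: triple_def simp del: mod_less_divisor)
  then have 1: "t mod m = u mod m" using eq by auto
  have "m + 2 * (t div m) + 2 \<in> triple m u"
    unfolding eq[symmetric] by (simp add: triple_def)
  then have "m + 2 * (t div m) + 2 = m + 2 * (u div m) + 1 \<or>
      m + 2 * (t div m) + 2 = m + 2 * (u div m) + 2"
    using lt(2) by (auto simp: triple_def simp del: mod_less_divisor)
  moreover have "p = q" if "m + 2 * p + 2 = m + 2 * q + 1 \<or> m + 2 * p + 2 = m + 2 * q + 2" for p q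
    using that by presburger
  ultimately have "t div m = u div m" by blast
  with 1 show "t = u" by (metis div_mult_mod_eq)
qed

text \<open>
  Two of the first \<open>N\<close> triples lie in the same clique exactly when their indices are \<open>t\<close> and
  \<open>t + i * m\<close> for some \<open>i \<ge> 1\<close>, and for given \<open>i\<close> there are \<open>N - i * m\<close> such pairs. The condition
  \<open>n + s \<le> L * m\<close> says that \<open>L\<close> two-element sets suffice.
\<close>
lemma exists_family_few_odd_pairs:
  assumes m: "m > 0" and n: "n = m + 2 * L" and N: "n + s \<le> L * m"
  shows "\<exists>\<A>\<in>odd_families s n. op_number \<A> \<le> (\<Sum>i=1..L. (n + s) - i * m)"
proof
  let ?N = "n + s"
  let ?F = "triple m"
  let ?\<A> = "?F ` {..<?N}"
  show "?\<A> \<in> odd_families s n"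
  proof -
    have "?F t \<subseteq> {1..n}" if "t < ?N" for t
    proof -
      have "t div m < L" using that N m by (simp add: less_mult_imp_div_less)
      moreover have "t mod m < m" using m by simp
      ultimately show ?thesis using n by (auto simp: triple_def)
    qed
    moreover have "odd (card (?F t))" for t using odd_card_triple_Int[OF m, of t t] by simp
    moreover have "card ?\<A> = ?N"
      using inj_triple[OF m] by (simp add: card_image inj_on_subset)
    ultimately show ?thesis by (auto simp: odd_families_def odd_sized_def)
  qed
  let ?P = "\<lambda>i. (\<lambda>t. {?F t, ?F (t + i * m)}) ` {..<?N - i * m}"
  have pair: "{?F t, ?F u} \<in> (\<Union>i\<in>{1..L}. ?P i)"
    if tu: "t < u" "u < ?N" "t mod m = u mod m" for t u
  proof -
    define i where "i = (u - t) div m"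
    have "m dvd u - t" using tu by (metis mod_eq_dvd_iff_nat less_imp_le)
    then have u: "u = t + i * m" using tu by (simp add: i_def)
    have "i \<ge> 1" using u tu by (cases i) auto
    moreover have "i * m < L * m" using u tu N by linarith
    then have "i \<le> L" by simp
    moreover have "t < ?N - i * m" using u tu by linarith
    ultimately show ?thesis unfolding u by force
  qed
  have "{{A, B} | A B. A \<in> ?\<A> \<and> B \<in> ?\<A> \<and> A \<noteq> B \<and> odd (card (A \<inter> B))} \<subseteq> (\<Union>i\<in>{1..L}. ?P i)"
  proof
    fix e assume "e \<in> {{A, B} | A B. A \<in> ?\<A> \<and> B \<in> ?\<A> \<and> A \<noteq> B \<and> odd (card (A \<inter> B))}"
    then obtain t u where e: "e = {?F t, ?F u}" and tu: "t < ?N" "u < ?N" "?F t \<noteq> ?F u"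
      "odd (card (?F t \<inter> ?F u))" by blast
    then have "t mod m = u mod m" using odd_card_triple_Int[OF m] by blast
    moreover have "t \<noteq> u" using tu by auto
    ultimately show "e \<in> (\<Union>i\<in>{1..L}. ?P i)"
      using pair[of t u] pair[of u t] e tu by (metis insert_commute linorder_neqE_nat)
  qed
  then have "op_number ?\<A> \<le> card (\<Union>i\<in>{1..L}. ?P i)"
    unfolding op_number_def by (intro card_mono) auto
  also have "\<dots> \<le> (\<Sum>i=1..L. card (?P i))" by (rule card_UN_le) simp
  also have "\<dots> \<le> (\<Sum>i=1..L. ?N - i * m)"
    by (intro sum_mono order_trans[OF card_image_le]) auto
  finally show "op_number ?\<A> \<le> (\<Sum>i=1..L. ?N - i * m)" .
qed

section \<open>Asymptotics\<close>

text \<open>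
  The construction is needed for the lower bound too: it shows that the minimum in the
  definition of \<open>M_o\<close> is taken over a nonempty set.
\<close>
lemma M_o_bounds:
  assumes "m > 0" "n = m + 2 * L" "n + s \<le> L * m"
  shows "(\<Sum>i=1..L. (n + s) - i * n) \<le> M_o s n"
    and "M_o s n \<le> (\<Sum>i=1..L. (n + s) - i * m)"
proof -
  have "odd_families s n \<subseteq> Pow (Pow {1..n})" by (auto simp: odd_families_def)
  then have fin: "finite (odd_families s n)" by (rule finite_subset) simp
  obtain \<A> where A: "\<A> \<in> odd_families s n" "op_number \<A> \<le> (\<Sum>i=1..L. (n + s) - i * m)"
    using exists_family_few_odd_pairs[OF assms] by blast
  have "M_o s n \<le> op_number \<A>" unfolding M_o_def using fin A by simp
  then show "M_o s n \<le> (\<Sum>i=1..L. (n + s) - i * m)" using A by simp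
  have "M_o s n \<in> op_number ` odd_families s n"
    unfolding M_o_def using fin A by (intro Min_in) auto
  then show "(\<Sum>i=1..L. (n + s) - i * n) \<le> M_o s n" using op_number_ge by auto
qed

lemma tendsto_clique_edge_density:
  fixes N m :: "nat \<Rightarrow> nat" and x :: real
  assumes N: "(\<lambda>n. real (N n) / real n) \<longlonglongrightarrow> x" and m: "(\<lambda>n. real (m n) / real n) \<longlonglongrightarrow> 1"
  shows "(\<lambda>n. real (\<Sum>i=1..L. N n - i * m n) / real n) \<longlonglongrightarrow> (\<Sum>i=1..L. max 0 (x - real i))"
proof -
  have "(\<lambda>n. \<Sum>i=1..L. max 0 (real (N n) / real n - real i * (real (m n) / real n)))
      \<longlonglongrightarrow> (\<Sum>i=1..L. max 0 (x - real i * 1))"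
    by (intro tendsto_intros N m)
  moreover have "real (a - i * b) / real n = max 0 (real a / real n - real i * (real b / real n))"
    for a b i n :: nat
  proof -
    have "real (a - i * b) = max 0 (real a - real i * real b)"
      by (cases "i * b \<le> a") (auto simp flip: of_nat_mult)
    then show ?thesis by (simp add: max_def divide_simps)
  qed
  ultimately show ?thesis by (simp add: sum_divide_distrib)
qed

text \<open>
  The truncation affects only the last summand; those with \<open>i \<le> \<lfloor>c\<rfloor> + 1\<close> are nonnegative
  and form an arithmetic progression.
\<close>
lemma sum_max_floor:
  fixes c :: real
  assumes "c \<ge> 0"
  shows "(\<Sum>i=1..nat \<lfloor>c\<rfloor> + 2. max 0 (1 + c - real i))
    = real ((nat \<lfloor>c\<rfloor> + 1) choose 2) + (of_int \<lfloor>c\<rfloor> + 1) * (c - of_int \<lfloor>c\<rfloor>)"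
proof -
  define k where "k = nat \<lfloor>c\<rfloor>"
  have k: "real k = of_int \<lfloor>c\<rfloor>" using assms by (simp add: k_def)
  have c: "real k \<le> c" "c < real k + 1" unfolding k by linarith+
  have choose: "real ((j + 1) choose 2) = real j * (real j + 1) / 2" for j
    by (induction j) (simp_all add: numeral_2_eq_2 field_simps)
  have "(\<Sum>i=1..k+2. max 0 (1 + c - real i)) = (\<Sum>i=1..k+1. max 0 (1 + c - real i))"
    using c by simp
  also have "\<dots> = (\<Sum>i=1..k+1. 1 + c - real i)"
    using c by (intro sum.cong) auto
  also have "\<dots> = (real k + 1) * c - real k * (real k + 1) / 2"
  proof -
    have "(\<Sum>i=1..j. 1 + c - real i) = real j * (1 + c) - real j * (real j + 1) / 2" for j
      by (induction j) (simp_all add: field_simps)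
    from this[of "k + 1"] show ?thesis by (simp add: field_simps)
  qed
  also have "\<dots> = real ((k + 1) choose 2) + (real k + 1) * (c - real k)"
    unfolding choose by (simp add: field_simps)
  finally show ?thesis by (simp add: k_def[symmetric] k[symmetric])
qed

theorem theorem1p3:
  fixes s :: "nat \<Rightarrow> nat" and c :: real
  assumes "\<And>n. n \<ge> 1 \<Longrightarrow> s n > 0"
    and "c > 0"
    and "(\<lambda>n. real (s n) - c * real n) \<in> o(\<lambda>n. real n)"
  shows "(\<lambda>n. real (M_o (s n) n)
            - (real ((nat \<lfloor>c\<rfloor> + 1) choose 2)
                + (of_int \<lfloor>c\<rfloor> + 1) * (c - of_int \<lfloor>c\<rfloor>)) * real n)
         \<in> o(\<lambda>n. real n)"
proof -
  \<comment> \<open>The cliques of the construction have at most \<open>L\<close> members; this leaves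
    room for all \<open>n + s n\<close> sets eventually, since the required average size tends to \<open>1 + c < L\<close>.\<close>
  define L where "L = nat \<lfloor>c\<rfloor> + 2"
  define C where "C = real ((nat \<lfloor>c\<rfloor> + 1) choose 2) + (of_int \<lfloor>c\<rfloor> + 1) * (c - of_int \<lfloor>c\<rfloor>)"
  have C: "C = (\<Sum>i=1..L. max 0 (1 + c - real i))"
    unfolding C_def L_def using sum_max_floor[of c] assms(2) by simp
  have cL: "1 + c < real L" unfolding L_def using assms(2) by simp linarith
  let ?m = "\<lambda>n. n - 2 * L"
  have nz: "eventually (\<lambda>n::nat. n > 0) sequentially" by (rule eventually_gt_at_top)
  have self: "(\<lambda>n. real n / real n) \<longlonglongrightarrow> 1"
    by (rule tendsto_eventually) (use nz in eventually_elim, simp)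
  have N: "(\<lambda>n. real (n + s n) / real n) \<longlonglongrightarrow> 1 + c"
  proof -
    have "(\<lambda>n. (real (s n) - c * real n) / real n) \<longlonglongrightarrow> 0"
      by (rule smalloD_tendsto[OF assms(3)])
    then have "(\<lambda>n. (real (s n) - c * real n) / real n + (1 + c)) \<longlonglongrightarrow> 0 + (1 + c)"
      by (intro tendsto_intros)
    moreover have "eventually (\<lambda>n. (real (s n) - c * real n) / real n + (1 + c)
        = real (n + s n) / real n) sequentially"
      using nz by eventually_elim (simp add: field_simps)
    ultimately have "(\<lambda>n. real (n + s n) / real n) \<longlonglongrightarrow> 0 + (1 + c)"
      by (rule Lim_transform_eventually)
    then show ?thesis by simp
  qed
  have m: "(\<lambda>n. real (?m n) / real n) \<longlonglongrightarrow> 1"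
  proof -
    have "(\<lambda>n. 1 - real (2 * L) / real n) \<longlonglongrightarrow> 1 - 0"
      by (intro tendsto_intros lim_const_over_n)
    moreover have "eventually (\<lambda>n. 1 - real (2 * L) / real n = real (?m n) / real n) sequentially"
      using eventually_gt_at_top[of "2 * L"]
      by eventually_elim (simp add: field_simps)
    ultimately have "(\<lambda>n. real (?m n) / real n) \<longlonglongrightarrow> 1 - 0"
      by (rule Lim_transform_eventually)
    then show ?thesis by simp
  qed
  have "eventually (\<lambda>n. real (n + s n) / real n < real L * (real (?m n) / real n)) sequentially"
  proof -
    have "(\<lambda>n. real L * (real (?m n) / real n) - real (n + s n) / real n)
        \<longlonglongrightarrow> real L * 1 - (1 + c)"
      by (intro tendsto_intros m N)
    then have "eventually (\<lambda>n. 0 < real L * (real (?m n) / real n) - real (n + s n) / real n) sequentially"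
      using cL by (intro order_tendstoD) auto
    then show ?thesis by eventually_elim simp
  qed
  then have size: "eventually (\<lambda>n. n + s n \<le> L * ?m n) sequentially"
    using nz
  proof eventually_elim
    case (elim n)
    have "real (n + s n) / real n < real (L * ?m n) / real n"
      using elim(1) by (simp only: of_nat_mult times_divide_eq_right)
    then have "real (n + s n) < real (L * ?m n)"
      by (rule contrapos_pp) (simp only: not_less divide_right_mono of_nat_0_le_iff)
    then show ?case by (simp only: of_nat_less_iff less_imp_le)
  qed
  have bounds: "eventually (\<lambda>n.
      real (\<Sum>i=1..L. (n + s n) - i * n) / real n \<le> real (M_o (s n) n) / real n \<and>
      real (M_o (s n) n) / real n \<le> real (\<Sum>i=1..L. (n + s n) - i * ?m n) / real n) sequentially"
    using size eventually_gt_at_top[of "2 * L"]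
  proof eventually_elim
    case (elim n)
    then have "?m n > 0" "n = ?m n + 2 * L" by auto
    from M_o_bounds[OF this elim(1)] show ?case
      by (intro conjI divide_right_mono) (simp_all only: of_nat_le_iff of_nat_0_le_iff)
  qed
  have "(\<lambda>n. real (M_o (s n) n) / real n) \<longlonglongrightarrow> C"
    unfolding C
  proof (rule tendsto_sandwich)
    show "(\<lambda>n. real (\<Sum>i=1..L. (n + s n) - i * n) / real n) \<longlonglongrightarrow> (\<Sum>i=1..L. max 0 (1 + c - real i))"
      by (rule tendsto_clique_edge_density[OF N self])
    show "(\<lambda>n. real (\<Sum>i=1..L. (n + s n) - i * ?m n) / real n) \<longlonglongrightarrow> (\<Sum>i=1..L. max 0 (1 + c - real i))"
      by (rule tendsto_clique_edge_density[OF N m])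
  qed (use bounds in \<open>eventually_elim, simp\<close>)+
  then have "(\<lambda>n. real (M_o (s n) n) / real n - C) \<longlonglongrightarrow> C - C"
    by (intro tendsto_intros)
  moreover have "eventually (\<lambda>n. real (M_o (s n) n) / real n - C
      = (real (M_o (s n) n) - C * real n) / real n) sequentially"
    using nz by eventually_elim (simp add: field_simps)
  ultimately have "(\<lambda>n. (real (M_o (s n) n) - C * real n) / real n) \<longlonglongrightarrow> C - C"
    by (rule Lim_transform_eventually)
  then have "(\<lambda>n. (real (M_o (s n) n) - C * real n) / real n) \<longlonglongrightarrow> 0" by simp
  then have "(\<lambda>n. real (M_o (s n) n) - C * real n) \<in> o(\<lambda>n. real n)"
    using nz by (intro smalloI_tendsto) (auto elim: eventually_mono)
  then show ?thesis unfolding C_def .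
qed

end
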